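(* Let $n$ be a nonnegative integer and let $f=\sum_{k=0}^n a_k t^k(1+t)^{n-k}$, where $a_k\ge 0$ are real numbers for all $0\le k\le n$. Then $\mathcal{A}(f)\in\mathcal{AL}_n$. In particular, $\mathcal{A}(f)$ is unimodal.
   Context: For $n\ge 0$, the $n$-th Eulerian polynomial is $A_n(t)=\sum_{k=0}^n A_{nk}t^k$, where $A_{nk}$ is the number of permutations $\sigma$ of $\{1,\dots,n\}$ such that $\sigma(i)\ge i$ for exactly $k$ indices $i$ (so $A_0(t)=1$). The map $\mathcal{A}:\mathbb{R}[t]\to\mathbb{R}[t]$ is the $\mathbb{R}$-linear operator determined by $\mathcal{A}(t^n)=A_n(t)$ for all $n\ge 0$. A polynomial with coefficient sequence $c_0,c_1,\ldots,c_n$ is unimodal if $c_0\le c_1\le\cdots\le c_k\ge\cdots\ge c_n$ for some $0\le k\le n$. For a polynomial $g\in\mathbb{R}[t]$ of degree at most $n$, let $\mathcal{I}_n(g)(t)=t^n g(1/t)$. Put $$a_n(g)=\frac{g-t\,\mathcal{I}_n(g)}{1-t},\qquad b_n(g)=\frac{\mathcal{I}_n(g)-g}{1-t};$$ these are polynomials and $g=a_n(g)+t\cdot b_n(g)$, with $\mathcal{I}_n(a_n(g))=a_n(g)$ and $\mathcal{I}_{n-1}(b_n(g))=b_n(g)$. Then $\mathcal{AL}_n$ is the convex cone of all polynomials $g$ of degree at most $n$ such that both $a_n(g)$ and $b_n(g)$ have nonnegative and unimodal coefficients. (Equivalently, the coefficients $c_0,\dots,c_n$ of $g$ satisfy the alternatingly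 increasing property $0\le c_0\le c_n\le c_1\le c_{n-1}\le\cdots\le c_{\lfloor (n+1)/2\rfloor}$.) *)

theory Defs
  imports Complex_Main "HOL-Computational_Algebra.Polynomial" "HOL-Combinatorics.Permutations"
begin

text \<open>Eulerian numbers count permutations by weak excedances (not by descents or strict
  excedances), so \<open>A\<^sub>n(t)\<close> is divisible by \<open>t\<close> for \<open>n \<ge> 1\<close>.\<close>

definition eulerian_num :: "nat \<Rightarrow> nat \<Rightarrow> nat" where
  "eulerian_num n k = card {\<sigma>. \<sigma> permutes {1..n} \<and> card {i \<in> {1..n}. \<sigma> i \<ge> i} = k}"

definition eulerian_poly :: "nat \<Rightarrow> real poly" where
  "eulerian_poly n = (\<Sum>k\<le>n. monom (real (eulerian_num n k)) k)"

text \<open>The lemmas following the next definition show that it is the unique linear map sending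
  \<open>t\<^sup>n\<close> to \<open>A\<^sub>n(t)\<close>.\<close>

definition eulerian_op :: "real poly \<Rightarrow> real poly" where
  "eulerian_op p = (\<Sum>n\<le>degree p. smult (coeff p n) (eulerian_poly n))"

lemma eulerian_op_altdef:
  assumes "degree p \<le> m"
  shows "eulerian_op p = (\<Sum>n\<le>m. smult (coeff p n) (eulerian_poly n))"
  unfolding eulerian_op_def
  by (rule sum.mono_neutral_left) (use assms in \<open>auto simp: coeff_eq_0\<close>)

lemma eulerian_op_add: "eulerian_op (p + q) = eulerian_op p + eulerian_op q"
proof -
  let ?m = "max (degree p) (degree q)"
  have "degree (p + q) \<le> ?m" by (simp add: degree_add_le)
  then show ?thesis
    by (simp add: eulerian_op_altdef[of _ ?m] smult_add_left sum.distrib)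
qed

lemma eulerian_op_smult: "eulerian_op (smult c p) = smult c (eulerian_op p)"
  by (rule poly_eqI)
    (simp add: eulerian_op_altdef[of _ "degree p"] degree_smult_le coeff_sum sum_distrib_left
      mult.assoc)

lemma eulerian_op_monom: "eulerian_op (monom 1 n) = eulerian_poly n"
proof -
  have "eulerian_op (monom 1 n) = (\<Sum>m\<le>n. if m = n then eulerian_poly m else 0)"
    unfolding eulerian_op_def by (intro sum.cong) (auto simp: degree_monom_eq)
  then show ?thesis by simp
qed

lemma eulerian_op_unique:
  assumes add: "\<And>p q. L (p + q) = L p + L q"
    and smult: "\<And>c p. L (smult c p) = smult c (L p)"
    and monom: "\<And>n. L (monom 1 n) = eulerian_poly n"
  shows "L = eulerian_op"
proof
  fix p :: "real poly"
  have zero: "L 0 = 0" using smult[of 0 0] by simp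
  have sum: "L (sum g S) = (\<Sum>i\<in>S. L (g i))" if "finite S" for g and S :: "nat set"
    using that by (induction S rule: finite_induct) (auto simp: zero add)
  have "L p = L (\<Sum>n\<le>degree p. smult (coeff p n) (monom 1 n))"
    by (simp add: smult_monom poly_as_sum_of_monoms)
  also have "\<dots> = eulerian_op p"
    by (simp add: sum smult monom eulerian_op_def)
  finally show "L p = eulerian_op p" .
qed

text \<open>The coefficient sequence of \<open>p\<close> is taken up to index \<open>degree p\<close>; for nonnegative
  coefficients, appending zeros makes no difference.\<close>

definition unimodal_poly :: "real poly \<Rightarrow> bool" where
  "unimodal_poly p \<longleftrightarrow> (\<exists>k\<le>degree p.
     (\<forall>i<k. coeff p i \<le> coeff p (Suc i)) \<and>
     (\<forall>i. k \<le> i \<and> i < degree p \<longrightarrow> coeff p (Suc i) \<le> coeff p i))"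

definition nonneg_poly :: "real poly \<Rightarrow> bool" where
  "nonneg_poly p \<longleftrightarrow> (\<forall>i. 0 \<le> coeff p i)"

text \<open>\<open>\<I>\<^sub>n(g)(t) = t\<^sup>n g(1/t)\<close>, meaningful for \<open>degree g \<le> n\<close> only. Unlike
  \<^const>\<open>reflect_poly\<close>, the reversal is with respect to \<open>n\<close>, not to the degree.\<close>

definition recip_poly :: "nat \<Rightarrow> real poly \<Rightarrow> real poly" where
  "recip_poly n g = (\<Sum>k\<le>n. monom (coeff g k) (n - k))"

lemma poly_recip_poly:
  assumes "degree g \<le> n" and "x \<noteq> 0"
  shows "poly (recip_poly n g) x = x ^ n * poly g (1 / x)"
proof -
  have "poly g (1 / x) = (\<Sum>k\<le>n. coeff g k * (1 / x) ^ k)"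
    unfolding poly_altdef
    by (rule sum.mono_neutral_left) (use assms(1) in \<open>auto simp: coeff_eq_0\<close>)
  then show ?thesis
    using assms(2)
    by (auto simp: recip_poly_def poly_sum poly_monom sum_distrib_left power_diff
        power_one_over field_simps intro!: sum.cong)
qed

text \<open>\<^term>\<open>[:0, 1:]\<close> is \<open>t\<close> and \<^term>\<open>[:1, -1:]\<close> is \<open>1 - t\<close>; for \<open>degree g \<le> n\<close> both divisions
  are exact.\<close>

definition a_part :: "nat \<Rightarrow> real poly \<Rightarrow> real poly" where
  "a_part n g = (g - [:0, 1:] * recip_poly n g) div [:1, -1:]"

definition b_part :: "nat \<Rightarrow> real poly \<Rightarrow> real poly" where
  "b_part n g = (recip_poly n g - g) div [:1, -1:]"

lemma one_minus_t_dvd: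
  assumes "poly p 1 = 0"
  shows "[:1, -1:] dvd (p :: real poly)"
proof -
  have "[:-1, 1:] dvd p" using assms by (simp add: poly_eq_0_iff_dvd)
  then have "- [:-1, 1:] dvd p" by (simp only: minus_dvd_iff)
  then show ?thesis by simp
qed

lemma
  assumes "degree g \<le> n"
  shows a_part_mult: "[:1, -1:] * a_part n g = g - [:0, 1:] * recip_poly n g"
    and b_part_mult: "[:1, -1:] * b_part n g = recip_poly n g - g"
proof -
  have "poly (recip_poly n g) 1 = poly g 1"
    using poly_recip_poly[OF assms, of 1] by simp
  then show "[:1, -1:] * a_part n g = g - [:0, 1:] * recip_poly n g"
    and "[:1, -1:] * b_part n g = recip_poly n g - g"
    unfolding a_part_def b_part_def by (intro dvd_mult_div_cancel one_minus_t_dvd; simp)+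
qed

lemma a_part_b_part:
  assumes "degree g \<le> n"
  shows "g = a_part n g + [:0, 1:] * b_part n g"
proof -
  let ?t = "[:0, 1:] :: real poly" and ?u = "[:1, -1:] :: real poly"
  have "?u * (a_part n g + ?t * b_part n g) = ?u * a_part n g + ?t * (?u * b_part n g)"
    by (simp only: distrib_left mult.left_commute)
  also have "\<dots> = (1 - ?t) * g"
    unfolding a_part_mult[OF assms] b_part_mult[OF assms] by algebra
  also have "1 - ?t = ?u"
    by (simp add: one_pCons)
  finally have "?u * (a_part n g + ?t * b_part n g) = ?u * g" .
  then have "a_part n g + ?t * b_part n g = g"
    by (subst (asm) mult_left_cancel) simp_all
  then show ?thesis by simp
qed

definition AL :: "nat \<Rightarrow> real poly set" where
  "AL n = {g. degree g \<le> n \<and>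
     nonneg_poly (a_part n g) \<and> unimodal_poly (a_part n g) \<and>
     nonneg_poly (b_part n g) \<and> unimodal_poly (b_part n g)}"

end

theory Submission
  imports Defs "HOL-Library.Infinite_Set"
begin

text \<open>
  Let \<open>D\<^sub>n\<close> be the generating polynomial of the derangements of \<open>n\<close> points by the number of
  exceedances \<open>i < \<sigma> i\<close>. Splitting a permutation into its fixed points and a derangement of the
  other points gives \<open>A\<^sub>n = \<Sum>\<^sub>i (n choose i) t\<^sup>i D\<^bsub>n-i\<^esub>\<close>, because a fixed point is a weak exceedance
  but not an exceedance. Counting by exceedances instead, each fixed point has weight \<open>1\<close>;
  a cyclic shift of the arguments turns exceedances into weak exceedances and creates one more,
  so that \<open>A\<^sub>n = t \<Sum>\<^sub>i (n choose i) D\<^bsub>n-i\<^esub>\<close> for \<open>n > 0\<close>. Subtracting the two expansions and dividing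
  by \<open>1 - t\<close> leaves the recurrence (lemma \<open>derangement_poly_recurrence\<close>)
  \<open>D\<^sub>n = \<Sum>\<^bsub>i>0\<^esub> (n choose i) (t + \<dots> + t\<^bsup>i-1\<^esup>) D\<^bsub>n-i\<^esub>\<close>. Since products of palindromic unimodal
  polynomials with nonnegative coefficients are again of this kind, and their centres of symmetry
  add up, \<open>D\<^sub>n\<close> is palindromic with centre \<open>n/2\<close> and unimodal.

  Next consider \<open>R = \<Sum>\<^sub>i (k choose i) t\<^sup>i D\<^bsub>n-i\<^esub>\<close> with \<open>k \<le> n\<close>, which counts the permutations of \<open>n\<close>
  points all of whose fixed points lie among \<open>k\<close> given ones. Each \<open>D\<^bsub>n-i\<^esub>\<close> has centre \<open>(n-i)/2\<close>, so
  reversal with respect to \<open>n\<close> just replaces \<open>t\<^sup>i\<close> by \<open>1\<close>. Hence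
  \<open>b = \<Sum>\<^bsub>i>0\<^esub> (k choose i) (1 + \<dots> + t\<^bsup>i-1\<^esup>) D\<^bsub>n-i\<^esub>\<close>, and
  \<open>a = D\<^sub>n - \<Sum>\<^bsub>i>0\<^esub> (k choose i) (t + \<dots> + t\<^bsup>i-1\<^esup>) D\<^bsub>n-i\<^esub>\<close>.
  The recurrence for \<open>D\<^sub>n\<close> makes the minus sign in \<open>a\<close> harmless: the coefficients become
  \<open>(n choose i) - (k choose i) \<ge> 0\<close>. So both parts are nonnegative combinations of palindromic
  unimodal polynomials with the right centre (lemma \<open>rel_derangement_poly_in_alt_cone\<close>).

  Finally, \<open>\<A>(t\<^sup>k (1+t)\<^sup>r)\<close> arises from the polynomials \<open>R\<close> by additions and
  multiplications by \<open>1 + t\<close>: a fixed point among the last \<open>r\<close> points may be chosen or not and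
  thus has weight \<open>t + 1\<close>. Multiplication by the palindromic polynomial \<open>1 + t\<close> respects both parts
  of the decomposition and raises the degree bound by one, which proves the claim for each
  \<open>t\<^sup>k (1+t)\<^bsup>n-k\<^esup>\<close>, and then for \<open>f\<close> by convexity.
\<close>

section \<open>Geometric sums\<close>

text \<open>A constant, so that the simplifier does not turn products with \<open>t\<close> into \<^const>\<open>pCons\<close>.\<close>

definition X :: "real poly" where "X = [:0, 1:]"

lemma coeff_X_power: "coeff (X ^ j) i = (if i = j then 1 else 0)"
  using coeff_monom[of "1::real" j i] by (simp add: X_def monom_altdef)

lemma coeff_X_mult_Suc: "coeff (X * p) (Suc i) = coeff p i"
  by (simp add: X_def)

lemma coeff_X_mult_0: "coeff (X * p) 0 = 0"
  by (simp add: X_def)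

lemma one_minus_X: "[:1, -1:] = 1 - X"
  by (simp add: X_def one_pCons)

lemma one_plus_X: "[:1, 1:] = 1 + X"
  by (simp add: X_def one_pCons)

lemma one_minus_X_nonzero: "1 - X \<noteq> 0"
  by (simp flip: one_minus_X)

definition geo :: "nat \<Rightarrow> real poly" where
  "geo l = (\<Sum>i<l. X ^ i)"

lemma geo_0 [simp]: "geo 0 = 0"
  by (simp add: geo_def)

lemma geo_Suc: "geo (Suc l) = geo l + X ^ l"
  by (simp add: geo_def)

lemma geo_one_minus_X: "(1 - X) * geo l = 1 - X ^ l"
  by (simp add: geo_def one_diff_power_eq)

lemma coeff_X_power_geo: "coeff (X ^ j * geo l) i = (if j \<le> i \<and> i < j + l then 1 else 0)"
proof (induction l)
  case (Suc l)
  then show ?case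
    by (auto simp: geo_Suc distrib_left coeff_X_power simp flip: power_add)
qed simp

text \<open>One step of the decomposition of a product of two geometric sums into concentric ones (the
  Clebsch-Gordan rule): \<open>geo (Suc (k + l))\<close> has the full support, and the rest is shorter by one
  term at both ends.\<close>

lemma geo_mult_Suc_Suc: "geo (Suc k) * geo (Suc l) = geo (Suc (k + l)) + X * (geo k * geo l)"
proof -
  have "(1 - X) * ((1 - X) * (geo (Suc k) * geo (Suc l)))
      = ((1 - X) * geo (Suc k)) * ((1 - X) * geo (Suc l))"
    by (simp only: mult_ac)
  also have "\<dots> = (1 - X) * (1 - X ^ Suc (k + l)) + X * ((1 - X ^ k) * (1 - X ^ l))"
    unfolding geo_one_minus_X by (simp add: algebra_simps power_add)
  also have "\<dots> = (1 - X) * ((1 - X) * (geo (Suc (k + l)) + X * (geo k * geo l)))"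
    unfolding geo_one_minus_X[symmetric] by (simp only: distrib_left mult_ac)
  finally show ?thesis
    using one_minus_X_nonzero by simp
qed

section \<open>Palindromic unimodal polynomials\<close>

text \<open>The nonnegative unimodal polynomials that are palindromic with centre \<open>n/2\<close> are the
  nonnegative combinations of the runs \<open>t\<^sup>j + \<dots> + t\<^bsup>n-j\<^esup>\<close>. With the runs as generators, closure
  under products and the inequalities between coefficients need to be checked on runs only. A run of
  length \<open>l = 0\<close> is the zero polynomial.\<close>

inductive_set pal_cone :: "nat \<Rightarrow> real poly set" for n :: nat where
  brick: "0 \<le> c \<Longrightarrow> 2 * j + l = Suc n \<Longrightarrow> smult c (X ^ j * geo l) \<in> pal_cone n"
| add: "p \<in> pal_cone n \<Longrightarrow> q \<in> pal_cone n \<Longrightarrow> p + q \<in> pal_cone n"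

lemma pal_cone_brick: "2 * j + l = Suc n \<Longrightarrow> X ^ j * geo l \<in> pal_cone n"
  using pal_cone.brick[of 1 j l n] by simp

lemma pal_cone_0: "0 \<in> pal_cone n"
  using pal_cone.brick[of 0 0 "Suc n" n] by simp

lemma pal_cone_1: "1 \<in> pal_cone 0"
  using pal_cone_brick[of 0 1 0] by (simp add: geo_Suc)

lemma pal_cone_one_plus_X: "1 + X \<in> pal_cone 1"
  using pal_cone_brick[of 0 2 1] by (simp add: geo_Suc numeral_2_eq_2)

lemma pal_cone_X_mult_geo: "X * geo l \<in> pal_cone (Suc l)"
  using pal_cone_brick[of 1 l "Suc l"] by simp

lemma pal_cone_smult: "p \<in> pal_cone n \<Longrightarrow> 0 \<le> c \<Longrightarrow> smult c p \<in> pal_cone n"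
  by (induction rule: pal_cone.induct) (simp_all add: smult_add_right pal_cone.intros)

lemma pal_cone_of_nat_mult: "p \<in> pal_cone n \<Longrightarrow> of_nat k * p \<in> pal_cone n"
  using pal_cone_smult[of p n "of_nat k"] by (simp add: of_nat_poly)

lemma pal_cone_sum: "(\<And>i. i \<in> I \<Longrightarrow> f i \<in> pal_cone n) \<Longrightarrow> sum f I \<in> pal_cone n"
  by (induction I rule: infinite_finite_induct) (auto simp: pal_cone_0 pal_cone.add)

text \<open>Repeated peeling writes the product of two runs as a sum of runs with the same centre.\<close>

lemma pal_cone_geo_mult: "2 * h + k + l = Suc (Suc n) \<Longrightarrow> X ^ h * (geo k * geo l) \<in> pal_cone n"
proof (induction k arbitrary: h l)
  case 0
  then show ?case by (simp add: pal_cone_0)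
next
  case (Suc k)
  show ?case
  proof (cases l)
    case 0
    then show ?thesis by (simp add: pal_cone_0)
  next
    case (Suc l')
    have "X ^ h * geo (Suc (k + l')) + X ^ Suc h * (geo k * geo l') \<in> pal_cone n"
      using Suc Suc.prems by (intro pal_cone.add pal_cone_brick Suc.IH) auto
    then show ?thesis
      unfolding Suc geo_mult_Suc_Suc by (simp only: distrib_left power_Suc mult_ac)
  qed
qed

lemma pal_cone_mult:
  assumes "p \<in> pal_cone m" and "q \<in> pal_cone n"
  shows "p * q \<in> pal_cone (m + n)"
  using assms
proof (induction p rule: pal_cone.induct)
  case p: (brick c i k)
  from p(3) show ?case
  proof (induction q rule: pal_cone.induct)
    case (brick d j l)
    have "smult (c * d) (X ^ (i + j) * (geo k * geo l)) \<in> pal_cone (m + n)"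
      using p brick by (intro pal_cone_smult pal_cone_geo_mult) auto
    then show ?case
      by (simp add: power_add mult_ac)
  next
    case (add q r)
    then show ?case by (simp only: distrib_left pal_cone.add)
  qed
next
  case (add p r)
  then show ?case by (simp add: distrib_right pal_cone.add)
qed

lemma pal_cone_nonneg: "p \<in> pal_cone n \<Longrightarrow> 0 \<le> coeff p i"
  by (induction rule: pal_cone.induct) (simp_all add: coeff_X_power_geo)

lemma pal_cone_coeff_eq_0: "p \<in> pal_cone n \<Longrightarrow> n < i \<Longrightarrow> coeff p i = 0"
  by (induction rule: pal_cone.induct) (auto simp: coeff_X_power_geo)

lemma pal_cone_sym: "p \<in> pal_cone n \<Longrightarrow> i \<le> n \<Longrightarrow> coeff p (n - i) = coeff p i"
  by (induction rule: pal_cone.induct) (auto simp: coeff_X_power_geo)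

lemma pal_cone_ascending:
  "p \<in> pal_cone n \<Longrightarrow> 2 * i + 1 \<le> n \<Longrightarrow> coeff p i \<le> coeff p (Suc i)"
  by (induction rule: pal_cone.induct) (auto simp: coeff_X_power_geo intro: add_mono)

lemma pal_cone_descending:
  "p \<in> pal_cone n \<Longrightarrow> n \<le> 2 * i + 1 \<Longrightarrow> coeff p (Suc i) \<le> coeff p i"
  by (induction rule: pal_cone.induct) (auto simp: coeff_X_power_geo intro: add_mono)

text \<open>The peak \<open>k\<close> may lie beyond the degree; this happens for the zero polynomial.\<close>

lemma unimodal_polyI:
  assumes asc: "\<And>i. i < k \<Longrightarrow> coeff p i \<le> coeff p (Suc i)"
    and desc: "\<And>i. k \<le> i \<Longrightarrow> coeff p (Suc i) \<le> coeff p i"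
  shows "unimodal_poly p"
  unfolding unimodal_poly_def
  by (rule exI[of _ "min k (degree p)"]) (auto intro: asc desc)

section \<open>Sums of two palindromic parts\<close>

text \<open>A description of \<open>AL n\<close> by explicit decompositions. The condition that \<open>b\<close> has centre
  \<open>(n - 1)/2\<close> is stated for \<open>X * b\<close>, with centre \<open>(n + 1)/2\<close>, which is meaningful for \<open>n = 0\<close> as
  well, where it forces \<open>b = 0\<close>.\<close>

definition alt_cone :: "nat \<Rightarrow> real poly set" where
  "alt_cone n = {a + X * b |a b. a \<in> pal_cone n \<and> X * b \<in> pal_cone (Suc n)}"

lemma alt_cone_add: "p \<in> alt_cone n \<Longrightarrow> q \<in> alt_cone n \<Longrightarrow> p + q \<in> alt_cone n"
proof -
  assume "p \<in> alt_cone n" "q \<in> alt_cone n"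
  then obtain a b a' b' where "p = a + X * b" "q = a' + X * b'"
    and mem: "a \<in> pal_cone n" "X * b \<in> pal_cone (Suc n)"
      "a' \<in> pal_cone n" "X * b' \<in> pal_cone (Suc n)"
    by (auto simp: alt_cone_def)
  then have "p + q = (a + a') + X * (b + b')"
    by (simp add: algebra_simps)
  moreover have "X * (b + b') \<in> pal_cone (Suc n)"
    using mem by (simp only: distrib_left pal_cone.add)
  ultimately show ?thesis
    using pal_cone.add[OF mem(1,3)] unfolding alt_cone_def by blast
qed

lemma alt_cone_0: "0 \<in> alt_cone n"
  unfolding alt_cone_def using pal_cone_0 by (auto intro!: exI[of _ 0])

lemma alt_cone_smult: "p \<in> alt_cone n \<Longrightarrow> 0 \<le> c \<Longrightarrow> smult c p \<in> alt_cone n"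
proof -
  assume "p \<in> alt_cone n" "0 \<le> c"
  then obtain a b where p: "p = a + X * b" and mem: "a \<in> pal_cone n" "X * b \<in> pal_cone (Suc n)"
    by (auto simp: alt_cone_def)
  have "smult c p = smult c a + X * smult c b"
    by (simp add: p smult_add_right)
  moreover have "X * smult c b \<in> pal_cone (Suc n)"
    using pal_cone_smult[OF mem(2) \<open>0 \<le> c\<close>] by simp
  ultimately show ?thesis
    using pal_cone_smult[OF mem(1) \<open>0 \<le> c\<close>] unfolding alt_cone_def by blast
qed

lemma alt_cone_sum: "(\<And>i. i \<in> I \<Longrightarrow> f i \<in> alt_cone n) \<Longrightarrow> sum f I \<in> alt_cone n"
  by (induction I rule: infinite_finite_induct) (auto simp: alt_cone_0 alt_cone_add)

lemma alt_cone_one_plus_X_mult: "p \<in> alt_cone n \<Longrightarrow> (1 + X) * p \<in> alt_cone (Suc n)"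
proof -
  assume "p \<in> alt_cone n"
  then obtain a b where p: "p = a + X * b" and mem: "a \<in> pal_cone n" "X * b \<in> pal_cone (Suc n)"
    by (auto simp: alt_cone_def)
  have "(1 + X) * p = (1 + X) * a + X * ((1 + X) * b)"
    by (simp only: p distrib_left mult.left_commute)
  moreover have "(1 + X) * a \<in> pal_cone (Suc n)"
    using pal_cone_mult[OF pal_cone_one_plus_X mem(1)] by simp
  moreover have "X * ((1 + X) * b) \<in> pal_cone (Suc (Suc n))"
    using pal_cone_mult[OF pal_cone_one_plus_X mem(2)] by (simp add: mult.left_commute)
  ultimately show ?thesis
    unfolding alt_cone_def by blast
qed

lemma coeff_recip_poly: "coeff (recip_poly n g) i = (if i \<le> n then coeff g (n - i) else 0)"
proof -
  have "coeff (recip_poly n g) i = (\<Sum>k\<le>n. if n - k = i then coeff g k else 0)"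
    by (simp add: recip_poly_def coeff_sum)
  also have "\<dots> = (\<Sum>k\<le>n. if k = n - i \<and> i \<le> n then coeff g k else 0)"
    by (intro sum.cong) auto
  finally show ?thesis
    by simp
qed

text \<open>Any decomposition \<open>g = a + X * b\<close> with these symmetries is the canonical one, since reversal
  with respect to \<open>n\<close> fixes \<open>a\<close> and maps \<open>X * b\<close> to \<open>b\<close>. The sum \<open>g\<close> itself is unimodal because the
  centres \<open>n/2\<close> and \<open>(n + 1)/2\<close> are so close that both parts have a peak at \<open>(n + 1) div 2\<close>.\<close>

lemma alt_cone_imp_AL:
  assumes "g \<in> alt_cone n"
  shows "g \<in> AL n" and "unimodal_poly g"
proof -
  from assms obtain a b where g: "g = a + X * b"
    and a: "a \<in> pal_cone n" and b: "X * b \<in> pal_cone (Suc n)"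
    by (auto simp: alt_cone_def)
  \<comment> \<open>The constant coefficient of \<open>X * b\<close> vanishes, hence by symmetry also the one of degree
    \<open>n + 1\<close>, so that \<open>b\<close> has degree less than \<open>n\<close>.\<close>
  have b_eq_0: "coeff b i = 0" if "n \<le> i" for i
  proof (cases "i = n")
    case True
    have "coeff (X * b) (Suc n) = coeff (X * b) 0"
      using pal_cone_sym[OF b, of 0] by simp
    then show ?thesis
      by (simp add: True coeff_X_mult_Suc coeff_X_mult_0)
  next
    case False
    then show ?thesis
      using pal_cone_coeff_eq_0[OF b, of "Suc i"] that by (simp add: coeff_X_mult_Suc)
  qed
  have recip: "recip_poly n g = a + b"
  proof (rule poly_eqI)
    fix i
    have "coeff (X * b) (n - i) = coeff b i" if "i \<le> n"
      using pal_cone_sym[OF b, of "Suc i"] that by (simp add: coeff_X_mult_Suc)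
    then show "coeff (recip_poly n g) i = coeff (a + b) i"
      using pal_cone_sym[OF a, of i] pal_cone_coeff_eq_0[OF a, of i] b_eq_0[of i]
      by (auto simp: g coeff_recip_poly)
  qed
  have "g - X * recip_poly n g = (1 - X) * a" and "recip_poly n g - g = (1 - X) * b"
    unfolding recip by (simp_all add: g algebra_simps)
  then have parts: "a_part n g = a" "b_part n g = b"
    unfolding a_part_def b_part_def one_minus_X X_def[symmetric]
    using one_minus_X_nonzero by simp_all
  have "degree g \<le> n"
  proof (rule degree_le, intro allI impI)
    fix i assume "n < i"
    then show "coeff g i = 0"
      using pal_cone_coeff_eq_0[OF a, of i] b_eq_0[of "i - 1"]
      by (cases i) (auto simp: g coeff_X_mult_Suc)
  qed
  moreover have "nonneg_poly a" "nonneg_poly b"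
    using pal_cone_nonneg[OF a] pal_cone_nonneg[OF b, of "Suc _"]
    by (auto simp: nonneg_poly_def coeff_X_mult_Suc)
  moreover have "unimodal_poly a"
    by (rule unimodal_polyI[of "n div 2"])
      (auto intro: pal_cone_ascending[OF a] pal_cone_descending[OF a])
  moreover have "unimodal_poly b"
    using pal_cone_ascending[OF b, of "Suc _"] pal_cone_descending[OF b, of "Suc _"]
    by (intro unimodal_polyI[of "(n - 1) div 2"]) (auto simp: coeff_X_mult_Suc)
  ultimately show "g \<in> AL n"
    by (simp add: AL_def parts)
  show "unimodal_poly g"
    unfolding g coeff_add
    by (rule unimodal_polyI[of "(n + 1) div 2"]; unfold coeff_add;
        intro add_mono pal_cone_ascending[OF a] pal_cone_descending[OF a]
          pal_cone_ascending[OF b] pal_cone_descending[OF b]; linarith)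
qed

section \<open>Counting permutations by fixed points and exceedances\<close>

definition exc :: "(nat \<Rightarrow> nat) \<Rightarrow> nat" where
  "exc \<sigma> = card {i. i < \<sigma> i}"

definition derangements :: "nat set \<Rightarrow> (nat \<Rightarrow> nat) set" where
  "derangements S = {\<sigma>. \<sigma> permutes S \<and> (\<forall>i\<in>S. \<sigma> i \<noteq> i)}"

definition derangement_poly :: "nat \<Rightarrow> real poly" where
  "derangement_poly n = (\<Sum>\<sigma>\<in>derangements {..<n}. X ^ exc \<sigma>)"

lemma derangement_poly_0: "derangement_poly 0 = 1"
  by (simp add: derangement_poly_def derangements_def exc_def)

text \<open>Relabelling the points by an increasing bijection preserves exceedances.\<close>

lemma sum_derangements_eq_derangement_poly:
  assumes "finite S"
  shows "(\<Sum>\<sigma>\<in>derangements S. X ^ exc \<sigma>) = derangement_poly (card S)"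
proof -
  obtain h where h: "bij_betw h {..<card S} S" and mono: "strict_mono_on {..<card S} h"
    using ex_bij_betw_strict_mono_card[OF assms] .
  let ?g = "inv_into {..<card S} h"
  let ?conj = "\<lambda>\<pi> x. if x \<in> S then h (\<pi> (?g x)) else x"
  have "exc (?conj \<pi>) = exc \<pi>" if "\<pi> permutes {..<card S}" for \<pi>
  proof -
    have less: "h i < h j \<longleftrightarrow> i < j" if "i < card S" "j < card S" for i j
      using strict_mono_on_less[OF mono] that by simp
    have in_range: "\<pi> i < card S" if "i < card S" for i
      using permutes_in_image[OF \<open>\<pi> permutes _\<close>, of i] that by simp
    have dom: "i < card S" if "i < \<pi> i" for i
      using permutes_not_in[OF \<open>\<pi> permutes _\<close>, of i] that by (cases "i < card S") auto
    have conj_h: "?conj \<pi> (h i) = h (\<pi> i)" if "i < card S" for i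
      using that h by (auto simp: bij_betw_inv_into_left dest: bij_betwE)
    have "{x. x < ?conj \<pi> x} = h ` {i. i < \<pi> i}"
    proof (intro equalityI subsetI)
      fix x assume "x \<in> {x. x < ?conj \<pi> x}"
      then have "x \<in> S" "x < ?conj \<pi> x" by (auto split: if_splits)
      then obtain i where "i < card S" "x = h i"
        using bij_betw_imp_surj_on[OF h] by auto
      with \<open>x < ?conj \<pi> x\<close> show "x \<in> h ` {i. i < \<pi> i}"
        by (auto simp only: conj_h less in_range)
    next
      fix x assume "x \<in> h ` {i. i < \<pi> i}"
      then obtain i where "i < \<pi> i" "x = h i" by auto
      then show "x \<in> {x. x < ?conj \<pi> x}"
        using less[of i "\<pi> i"] dom[of i] in_range[of i] by (simp only: mem_Collect_eq conj_h)
    qed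
    moreover have "inj_on h {i. i < \<pi> i}"
      by (rule inj_on_subset[OF bij_betw_imp_inj_on[OF h]]) (auto dest: dom)
    ultimately show ?thesis
      by (simp only: exc_def card_image)
  qed
  then have "derangement_poly (card S) = (\<Sum>\<pi>\<in>derangements {..<card S}. X ^ exc (?conj \<pi>))"
    unfolding derangement_poly_def by (intro sum.cong) (auto simp: derangements_def)
  also have "\<dots> = (\<Sum>\<sigma>\<in>derangements S. X ^ exc \<sigma>)"
    using bij_betw_derangements[OF h] unfolding derangements_def
    by (rule sum.reindex_bij_betw)
  finally show ?thesis ..
qed

lemma sum_subsets_by_card:
  fixes f :: "nat \<Rightarrow> 'a :: comm_semiring_1"
  assumes "finite S"
  shows "(\<Sum>F\<in>Pow S. f (card F)) = (\<Sum>i\<le>card S. of_nat (card S choose i) * f i)"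
proof -
  have "(\<Sum>F\<in>Pow S. f (card F)) = (\<Sum>i\<le>card S. \<Sum>F | F \<in> Pow S \<and> card F = i. f (card F))"
    using assms by (intro sum.group[symmetric]) (auto intro: card_mono)
  also have "\<dots> = (\<Sum>i\<le>card S. of_nat (card S choose i) * f i)"
    using assms by (intro sum.cong) (auto simp: n_subsets[symmetric])
  finally show ?thesis .
qed

text \<open>A permutation with fixed point set \<open>F\<close> is the same as a derangement of \<open>S - F\<close>. The weight \<open>u\<close>
  of a fixed point is left open: \<open>u = X\<close> counts weak exceedances, \<open>u = 1\<close> counts exceedances.\<close>

lemma fixed_point_expansion:
  assumes "finite S"
  shows "(\<Sum>\<sigma> | \<sigma> permutes S. u ^ card {i \<in> S. \<sigma> i = i} * X ^ exc \<sigma>)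
    = (\<Sum>i\<le>card S. of_nat (card S choose i) * (u ^ i * derangement_poly (card S - i)))"
proof -
  let ?fix = "\<lambda>\<sigma>. {i \<in> S. \<sigma> i = i}" and ?P = "{\<sigma>. \<sigma> permutes S}"
  let ?w = "\<lambda>\<sigma>. u ^ card (?fix \<sigma>) * X ^ exc \<sigma>"
  have "sum ?w ?P = (\<Sum>F\<in>Pow S. \<Sum>\<sigma> | \<sigma> \<in> ?P \<and> ?fix \<sigma> = F. ?w \<sigma>)"
    using assms by (intro sum.group[symmetric]) (auto intro: finite_permutations)
  also have "\<dots> = (\<Sum>F\<in>Pow S. u ^ card F * derangement_poly (card S - card F))"
  proof (intro sum.cong refl)
    fix F assume "F \<in> Pow S"
    then have F: "F \<subseteq> S" by simp
    have "{\<sigma>. \<sigma> \<in> ?P \<and> ?fix \<sigma> = F} = derangements (S - F)"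
    proof (intro equalityI subsetI)
      fix \<sigma> assume "\<sigma> \<in> {\<sigma>. \<sigma> \<in> ?P \<and> ?fix \<sigma> = F}"
      then have "\<sigma> permutes S" "?fix \<sigma> = F" by auto
      then show "\<sigma> \<in> derangements (S - F)"
        by (auto simp: derangements_def intro: permutes_superset)
    next
      fix \<sigma> assume \<sigma>: "\<sigma> \<in> derangements (S - F)"
      then have "\<sigma> i = i" if "i \<in> F" for i
        using permutes_not_in[of \<sigma> "S - F" i] that by (auto simp: derangements_def)
      then show "\<sigma> \<in> {\<sigma>. \<sigma> \<in> ?P \<and> ?fix \<sigma> = F}"
        using \<sigma> F by (auto simp: derangements_def intro: permutes_subset)
    qed
    moreover from this have "(\<Sum>\<sigma> | \<sigma> \<in> ?P \<and> ?fix \<sigma> = F. ?w \<sigma>)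
        = (\<Sum>\<sigma> | \<sigma> \<in> ?P \<and> ?fix \<sigma> = F. u ^ card F * X ^ exc \<sigma>)"
      by (intro sum.cong) auto
    ultimately show "(\<Sum>\<sigma> | \<sigma> \<in> ?P \<and> ?fix \<sigma> = F. ?w \<sigma>)
        = u ^ card F * derangement_poly (card S - card F)"
      using assms F finite_subset[OF F assms]
      by (simp only: sum_distrib_left[symmetric] sum_derangements_eq_derangement_poly
          finite_Diff card_Diff_subset)
  qed
  also have "\<dots> = (\<Sum>i\<le>card S. of_nat (card S choose i) * (u ^ i * derangement_poly (card S - i)))"
    using assms by (rule sum_subsets_by_card)
  finally show ?thesis .
qed

lemma exceedance_in_range:
  fixes \<sigma> :: "nat \<Rightarrow> nat"
  assumes "\<sigma> permutes {1..n}" and "i < \<sigma> i"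
  shows "1 \<le> i" and "i < n" and "\<sigma> i \<le> n"
proof -
  have "i \<in> {1..n}"
    using permutes_not_in[OF assms(1), of i] assms(2) by (cases "i \<in> {1..n}") auto
  moreover from this have "\<sigma> i \<in> {1..n}"
    by (simp only: permutes_in_image[OF assms(1)])
  ultimately show "1 \<le> i" and "i < n" and "\<sigma> i \<le> n"
    using assms(2) by auto
qed

lemma finite_exceedances:
  fixes \<sigma> :: "nat \<Rightarrow> nat"
  assumes "\<sigma> permutes {1..n}"
  shows "finite {i. i < \<sigma> i}"
  by (rule finite_subset[of _ "{..<n}"]) (auto dest: exceedance_in_range(2)[OF assms])

lemma card_weak_exceedances:
  assumes "\<sigma> permutes {1..n}"
  shows "card {i \<in> {1..n}. i \<le> \<sigma> i} = card {i \<in> {1..n}. \<sigma> i = i} + exc \<sigma>"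
proof -
  have "{i \<in> {1..n}. i \<le> \<sigma> i} = {i \<in> {1..n}. \<sigma> i = i} \<union> {i. i < \<sigma> i}"
    by (auto simp: le_less dest: exceedance_in_range[OF assms])
  then show ?thesis
    using finite_exceedances[OF assms]
    by (simp add: exc_def card_Un_disjoint disjoint_iff)
qed

lemma eulerian_poly_eq_sum_permutations:
  "eulerian_poly n = (\<Sum>\<sigma> | \<sigma> permutes {1..n}. X ^ card {i \<in> {1..n}. i \<le> \<sigma> i})"
proof -
  let ?wexc = "\<lambda>\<sigma>. card {i \<in> {1..n}. i \<le> \<sigma> i}" and ?P = "{\<sigma>. \<sigma> permutes {1..n}}"
  have "(\<Sum>\<sigma>\<in>?P. X ^ ?wexc \<sigma>) = (\<Sum>k\<le>n. \<Sum>\<sigma> | \<sigma> \<in> ?P \<and> ?wexc \<sigma> = k. X ^ ?wexc \<sigma>)"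
  proof (rule sum.group[symmetric])
    have "?wexc \<sigma> \<le> n" for \<sigma>
      by (rule order_trans[OF card_mono[of "{1..n}"]]) auto
    then show "?wexc ` ?P \<subseteq> {..n}"
      by blast
  qed (auto intro: finite_permutations)
  also have "\<dots> = (\<Sum>k\<le>n. monom (real (eulerian_num n k)) k)"
    unfolding eulerian_num_def
    by (intro sum.cong refl) (simp add: of_nat_poly monom_altdef flip: X_def)
  finally show ?thesis
    by (simp add: eulerian_poly_def)
qed

lemma eulerian_poly_expansion:
  "eulerian_poly n = (\<Sum>i\<le>n. of_nat (n choose i) * (X ^ i * derangement_poly (n - i)))"
proof -
  have "eulerian_poly n
      = (\<Sum>\<sigma> | \<sigma> permutes {1..n}. X ^ card {i \<in> {1..n}. \<sigma> i = i} * X ^ exc \<sigma>)"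
    unfolding eulerian_poly_eq_sum_permutations
    by (intro sum.cong refl) (simp only: card_weak_exceedances power_add mem_Collect_eq)
  then show ?thesis
    by (simp only: fixed_point_expansion finite_atLeastAtMost card_atLeastAtMost diff_Suc_1)
qed

text \<open>Composition with the cycle \<open>i + 1 \<mapsto> i\<close>, \<open>1 \<mapsto> n\<close> moves each exceedance at \<open>i\<close> to a weak
  exceedance at \<open>i + 1\<close>, and the new value at \<open>1\<close> is always a weak exceedance.\<close>

lemma eulerian_poly_eq_X_mult_sum_exc:
  assumes "0 < n"
  shows "eulerian_poly n = X * (\<Sum>\<sigma> | \<sigma> permutes {1..n}. X ^ exc \<sigma>)"
proof -
  define c :: "nat \<Rightarrow> nat" where
    "c i = (if i = 1 then n else if i \<in> {1..n} then i - 1 else i)" for i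
  have c: "c permutes {1..n}"
  proof (rule bij_imp_permutes)
    show "bij_betw c {1..n} {1..n}"
      by (rule bij_betw_byWitness[where f' = "\<lambda>i. if i = n then 1 else Suc i"])
        (use assms in \<open>auto simp: c_def\<close>)
    show "c i = i" if "i \<notin> {1..n}" for i
      using that assms by (auto simp: c_def)
  qed
  have "card {i \<in> {1..n}. i \<le> (\<sigma> \<circ> c) i} = Suc (exc \<sigma>)" if \<sigma>: "\<sigma> permutes {1..n}" for \<sigma>
  proof -
    have "1 \<le> \<sigma> n"
      using permutes_in_image[OF \<sigma>, of n] assms by simp
    then have "{i \<in> {1..n}. i \<le> (\<sigma> \<circ> c) i} = insert 1 (Suc ` {i. i < \<sigma> i})"
    proof (intro equalityI subsetI)
      fix i assume "i \<in> {i \<in> {1..n}. i \<le> (\<sigma> \<circ> c) i}"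
      then show "i \<in> insert 1 (Suc ` {i. i < \<sigma> i})"
        by (cases i) (auto simp: c_def split: if_splits)
    next
      fix i assume i: "i \<in> insert 1 (Suc ` {i. i < \<sigma> i})"
      show "i \<in> {i \<in> {1..n}. i \<le> (\<sigma> \<circ> c) i}"
      proof (cases "i = 1")
        case True
        then show ?thesis using \<open>1 \<le> \<sigma> n\<close> assms by (simp add: c_def)
      next
        case False
        then obtain j where "i = Suc j" "j < \<sigma> j" using i by auto
        then show ?thesis
          using exceedance_in_range[OF \<sigma>, of j] by (simp add: c_def)
      qed
    qed
    moreover have "1 \<notin> Suc ` {i. i < \<sigma> i}"
      using exceedance_in_range[OF \<sigma>, of 0] by auto
    ultimately show ?thesis
      using finite_exceedances[OF \<sigma>] by (simp add: exc_def card_image)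
  qed
  then have "(\<Sum>\<sigma> | \<sigma> permutes {1..n}. X ^ card {i \<in> {1..n}. i \<le> (\<sigma> \<circ> c) i})
      = X * (\<Sum>\<sigma> | \<sigma> permutes {1..n}. X ^ exc \<sigma>)"
    unfolding sum_distrib_left
    by (intro sum.cong refl) (simp only: power_Suc mem_Collect_eq)
  then show ?thesis
    unfolding eulerian_poly_eq_sum_permutations
    by (rule trans[OF sum_permutations_compose_right[OF c]])
qed

lemma eulerian_poly_expansion_exc:
  assumes "0 < n"
  shows "eulerian_poly n = X * (\<Sum>i\<le>n. of_nat (n choose i) * derangement_poly (n - i))"
  using fixed_point_expansion[of "{1..n}" 1]
  by (simp add: eulerian_poly_eq_X_mult_sum_exc[OF assms])

section \<open>Derangement polynomials\<close>

text \<open>The difference of the two expansions of the Eulerian polynomial, divided by \<open>1 - X\<close>.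
  No signs are left, and every summand has centre \<open>i + 1\<close> plus \<open>n - Suc i\<close>, halved, that is
  \<open>n/2\<close>; so palindromicity and unimodality pass from smaller derangement polynomials to this one.\<close>

lemma derangement_poly_recurrence:
  assumes "0 < n"
  shows "derangement_poly n
    = (\<Sum>i<n. of_nat (n choose Suc i) * (X * geo i * derangement_poly (n - Suc i)))"
proof -
  obtain m where n: "n = Suc m"
    using assms by (cases n) auto
  let ?D = "\<lambda>i. of_nat (n choose Suc i) * derangement_poly (n - Suc i)"
  have 1: "eulerian_poly n = derangement_poly n + (\<Sum>i<n. X ^ Suc i * ?D i)"
    unfolding eulerian_poly_expansion n lessThan_Suc_atMost sum.atMost_Suc_shift
    by (simp add: mult_ac)
  have 2: "eulerian_poly n = X * derangement_poly n + (\<Sum>i<n. X * ?D i)"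
    unfolding eulerian_poly_expansion_exc[OF assms]
    unfolding n lessThan_Suc_atMost sum.atMost_Suc_shift
    by (simp add: distrib_left sum_distrib_left)
  have "(1 - X) * derangement_poly n = (\<Sum>i<n. X * ?D i) - (\<Sum>i<n. X ^ Suc i * ?D i)"
    using 1 2 by (simp add: algebra_simps)
  also have "\<dots> = (\<Sum>i<n. (1 - X ^ i) * (X * ?D i))"
    unfolding sum_subtractf[symmetric] by (intro sum.cong) (simp_all add: algebra_simps)
  also have "\<dots> = (1 - X) *
      (\<Sum>i<n. of_nat (n choose Suc i) * (X * geo i * derangement_poly (n - Suc i)))"
    unfolding geo_one_minus_X[symmetric] sum_distrib_left by (simp only: mult_ac)
  finally show ?thesis
    using one_minus_X_nonzero by simp
qed

lemma derangement_poly_in_pal_cone: "derangement_poly n \<in> pal_cone n"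
proof (induction n rule: less_induct)
  case (less n)
  show ?case
  proof (cases "n = 0")
    case True
    then show ?thesis by (simp add: derangement_poly_0 pal_cone_1)
  next
    case False
    have "X * geo i * derangement_poly (n - Suc i) \<in> pal_cone n" if "i < n" for i
      using pal_cone_mult[OF pal_cone_X_mult_geo[of i] less.IH[of "n - Suc i"]] that by simp
    then show ?thesis
      using False by (subst derangement_poly_recurrence)
        (auto intro!: pal_cone_sum pal_cone_of_nat_mult)
  qed
qed

text \<open>These polynomials count by weak exceedances the permutations of \<open>k + m\<close> points of which the
  last \<open>m\<close> are not fixed. They interpolate between the derangement polynomials (\<open>k = 0\<close>) and the
  Eulerian polynomials (\<open>m = 0\<close>).\<close>

definition rel_derangement_poly :: "nat \<Rightarrow> nat \<Rightarrow> real poly" where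
  "rel_derangement_poly k m = (\<Sum>i\<le>k. of_nat (k choose i) * (X ^ i * derangement_poly (m + k - i)))"

text \<open>One more point that may be fixed: either it is not fixed, or it is, with weight \<open>X\<close>.\<close>

lemma rel_derangement_poly_Suc:
  "rel_derangement_poly (Suc k) m = rel_derangement_poly k (Suc m) + X * rel_derangement_poly k m"
proof -
  let ?D = derangement_poly
  have "rel_derangement_poly (Suc k) m = ?D (Suc (m + k)) +
      (\<Sum>i\<le>k. of_nat (k choose Suc i) * (X ^ Suc i * ?D (m + k - i))) +
      (\<Sum>i\<le>k. of_nat (k choose i) * (X ^ Suc i * ?D (m + k - i)))"
    unfolding rel_derangement_poly_def sum.atMost_Suc_shift
    by (simp add: distrib_right sum.distrib)
  also have "?D (Suc (m + k)) + (\<Sum>i\<le>k. of_nat (k choose Suc i) * (X ^ Suc i * ?D (m + k - i)))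
      = (\<Sum>i\<le>Suc k. of_nat (k choose i) * (X ^ i * ?D (Suc m + k - i)))"
    unfolding sum.atMost_Suc_shift by simp
  also have "\<dots> = rel_derangement_poly k (Suc m)"
    by (simp add: rel_derangement_poly_def)
  also have "(\<Sum>i\<le>k. of_nat (k choose i) * (X ^ Suc i * ?D (m + k - i))) = X * rel_derangement_poly k m"
    unfolding rel_derangement_poly_def sum_distrib_left by (simp only: power_Suc mult_ac)
  finally show ?thesis .
qed

lemma rel_derangement_poly_0_right: "rel_derangement_poly k 0 = eulerian_poly k"
  by (simp add: rel_derangement_poly_def eulerian_poly_expansion)

text \<open>The symmetric part \<open>a\<close> is \<open>D\<^sub>n\<close> minus terms of the same shape as those of the recurrence for
  \<open>D\<^sub>n\<close>, and smaller than these since \<open>k \<le> n\<close>.\<close>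

lemma rel_derangement_poly_in_alt_cone: "rel_derangement_poly k m \<in> alt_cone (k + m)"
proof (cases "k + m = 0")
  case True
  then have "rel_derangement_poly k m = 1 + X * 0"
    by (simp add: rel_derangement_poly_def derangement_poly_0)
  moreover have "1 \<in> pal_cone (k + m)" "X * 0 \<in> pal_cone (Suc (k + m))"
    using True pal_cone_0 pal_cone_1 by simp_all
  ultimately show ?thesis
    unfolding alt_cone_def by blast
next
  case False
  define n where "n = k + m"
  let ?D = "\<lambda>i. derangement_poly (n - Suc i)"
  define a where "a = (\<Sum>i<n. of_nat ((n choose Suc i) - (k choose Suc i)) * (X * geo i * ?D i))"
  define b where "b = (\<Sum>i<n. of_nat (k choose Suc i) * (geo (Suc i) * ?D i))"
  have D: "?D i \<in> pal_cone (n - Suc i)" for i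
    by (rule derangement_poly_in_pal_cone)
  have "X * geo i * ?D i \<in> pal_cone n" if "i < n" for i
    using pal_cone_mult[OF pal_cone_X_mult_geo[of i] D[of i]] that by simp
  then have a: "a \<in> pal_cone n"
    unfolding a_def by (auto intro!: pal_cone_sum pal_cone_of_nat_mult)
  have "X * geo (Suc i) * ?D i \<in> pal_cone (Suc n)" if "i < n" for i
    using pal_cone_mult[OF pal_cone_X_mult_geo[of "Suc i"] D[of i]] that by simp
  then have "(\<Sum>i<n. of_nat (k choose Suc i) * (X * geo (Suc i) * ?D i)) \<in> pal_cone (Suc n)"
    by (auto intro!: pal_cone_sum pal_cone_of_nat_mult)
  then have b: "X * b \<in> pal_cone (Suc n)"
    by (simp add: b_def sum_distrib_left mult_ac)
  have "rel_derangement_poly k m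
      = derangement_poly n + (\<Sum>i<k. of_nat (k choose Suc i) * (X ^ Suc i * ?D i))"
    unfolding rel_derangement_poly_def lessThan_Suc_atMost[symmetric] sum.lessThan_Suc_shift
    by (simp add: n_def add.commute)
  also have "(\<Sum>i<k. of_nat (k choose Suc i) * (X ^ Suc i * ?D i))
      = (\<Sum>i<n. of_nat (k choose Suc i) * (X ^ Suc i * ?D i))"
    by (rule sum.mono_neutral_left) (auto simp: n_def not_less)
  also have "derangement_poly n = (\<Sum>i<n. of_nat (n choose Suc i) * (X * geo i * ?D i))"
    using False by (intro derangement_poly_recurrence) (simp add: n_def)
  also have "\<dots> + (\<Sum>i<n. of_nat (k choose Suc i) * (X ^ Suc i * ?D i)) = a + X * b"
    unfolding a_def b_def sum_distrib_left sum.distrib[symmetric]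
  proof (intro sum.cong refl)
    fix i
    have "k choose Suc i \<le> n choose Suc i"
      by (simp add: n_def binomial_right_mono)
    then show "of_nat (n choose Suc i) * (X * geo i * ?D i) + of_nat (k choose Suc i) * (X ^ Suc i * ?D i)
      = of_nat ((n choose Suc i) - (k choose Suc i)) * (X * geo i * ?D i)
        + X * (of_nat (k choose Suc i) * (geo (Suc i) * ?D i))"
      by (simp add: geo_Suc of_nat_diff algebra_simps)
  qed
  finally show ?thesis
    using a b unfolding alt_cone_def n_def by blast
qed

section \<open>The Eulerian transformation\<close>

text \<open>With \<open>D\<close> the sequence of derangement polynomials and \<open>E\<close> the shift of sequences, this is the
  entry at \<open>m\<close> of \<open>(E + 1 + X)\<^sup>r (E + X)\<^sup>k D\<close>: it counts permutations of \<open>r + k + m\<close> points, where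
  a fixed point has weight \<open>1 + X\<close>, \<open>X\<close> or \<open>0\<close> according to the group it belongs to. The recursion
  on \<open>r\<close> uses only operations that preserve \<^const>\<open>alt_cone\<close>.\<close>

fun weighted_fix_poly :: "nat \<Rightarrow> nat \<Rightarrow> nat \<Rightarrow> real poly" where
  "weighted_fix_poly 0 k m = rel_derangement_poly k m"
| "weighted_fix_poly (Suc r) k m =
    weighted_fix_poly r k (Suc m) + (1 + X) * weighted_fix_poly r k m"

lemma weighted_fix_poly_Suc_k:
  "weighted_fix_poly r (Suc k) m = weighted_fix_poly r k (Suc m) + X * weighted_fix_poly r k m"
  by (induction r arbitrary: m) (simp_all add: rel_derangement_poly_Suc algebra_simps)

lemma weighted_fix_poly_in_alt_cone: "weighted_fix_poly r k m \<in> alt_cone (r + k + m)"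
proof (induction r arbitrary: m)
  case 0
  then show ?case by (simp add: rel_derangement_poly_in_alt_cone)
next
  case (Suc r)
  show ?case
    using alt_cone_add[OF Suc.IH[of "Suc m"]] alt_cone_one_plus_X_mult[OF Suc.IH[of m]] by simp
qed

text \<open>Both sides satisfy the recurrence that comes from
  \<open>X\<^sup>k (1 + X)\<^bsup>r+1\<^esup> = X\<^sup>k (1 + X)\<^sup>r + X\<^bsup>k+1\<^esup> (1 + X)\<^sup>r\<close>. The linear operator acts as \<open>X\<^sup>n \<mapsto> (E + X)\<^sup>n D\<close> at
  \<open>0\<close>, which replaces \<open>X\<close> by \<open>E + X\<close>.\<close>

lemma eulerian_op_basis: "eulerian_op (X ^ k * (1 + X) ^ r) = weighted_fix_poly r k 0"
proof (induction r arbitrary: k)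
  case 0
  then show ?case
    using eulerian_op_monom[of k] by (simp add: rel_derangement_poly_0_right X_def monom_altdef)
next
  case (Suc r)
  have "X ^ k * (1 + X) ^ Suc r = X ^ k * (1 + X) ^ r + X ^ Suc k * (1 + X) ^ r"
    by (simp add: algebra_simps)
  then have "eulerian_op (X ^ k * (1 + X) ^ Suc r)
      = weighted_fix_poly r k 0 + weighted_fix_poly r (Suc k) 0"
    by (simp only: eulerian_op_add Suc.IH)
  also have "\<dots> = weighted_fix_poly (Suc r) k 0"
    by (simp add: weighted_fix_poly_Suc_k algebra_simps)
  finally show ?case .
qed

lemma eulerian_op_sum:
  "eulerian_op (sum g I) = (\<Sum>i\<in>I. eulerian_op (g i))"
proof -
  have "eulerian_op 0 = 0"
    by (simp add: eulerian_op_def)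
  then show ?thesis
    by (induction I rule: infinite_finite_induct) (simp_all add: eulerian_op_add)
qed

theorem theorem3p2:
  fixes n :: nat and a :: "nat \<Rightarrow> real" and f :: "real poly"
  assumes "\<And>k. k \<le> n \<Longrightarrow> 0 \<le> a k"
    and "f = (\<Sum>k\<le>n. smult (a k) ([:0, 1:] ^ k * [:1, 1:] ^ (n - k)))"
  shows "eulerian_op f \<in> AL n \<and> unimodal_poly (eulerian_op f)"
proof -
  have "eulerian_op f = (\<Sum>k\<le>n. smult (a k) (weighted_fix_poly (n - k) k 0))"
    unfolding assms(2) one_plus_X X_def[symmetric]
    by (simp only: eulerian_op_sum eulerian_op_smult eulerian_op_basis)
  moreover have "weighted_fix_poly (n - k) k 0 \<in> alt_cone n" if "k \<le> n" for k
    using weighted_fix_poly_in_alt_cone[of "n - k" k 0] that by simp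
  ultimately have "eulerian_op f \<in> alt_cone n"
    using assms(1) by (auto intro!: alt_cone_sum alt_cone_smult)
  then show ?thesis
    by (simp add: alt_cone_imp_AL)
qed

end
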